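(* Let $1\le\omega<\infty$. (i) For every $n\ge2$ there is a diagonal Higham matrix $A=B+iC\in\mathcal H_n$ with $\kappa(B)=\kappa(C)=\omega$ and $\rho_{n,k}(A)=1/\omega$ for every stage $1\le k\le n-1$. Thus the constant $1/\omega$ in the lower bound "$\rho_{n,k}(A)\ge 1/\omega$ for all $A=B+iC\in\mathcal H_n$ with $\max\{\kappa(B),\kappa(C)\}\le\omega$" cannot be replaced by a larger one, even if one requires $\kappa(B)=\kappa(C)=\omega$ exactly. (ii) There is a $2\times2$ Higham matrix $A_\omega=B_\omega+iC_\omega\in\mathcal H_2$ such that $$\kappa(B_\omega)=\kappa(C_\omega)=\omega\quad\text{and}\quad \rho_2(A_\omega)=\frac{2(1+\omega^2)}{(1+\omega)^2}.$$ Consequently the constant in the upper bound "$\rho_n(A)\le \frac{2(1+\omega^2)}{(1+\omega)^2}$ for all $n\ge 2$ and all $A=B+iC\in\mathcal H_n$ with $\max\{\kappa(B),\kappa(C)\}\le\omega$" cannot be decreased.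
   Context: $\mathcal H_n$ (Higham matrices of order $n$) is the set of complex matrices $P+iQ$ with $P,Q\in\mathbb R^{n\times n}$ symmetric positive definite; writing $A=B+iC\in\mathcal H_n$, the matrices $B,C$ are these real symmetric positive definite parts. For an invertible matrix $X$, $\kappa(X)=\|X\|\,\|X^{-1}\|$ with $\|\cdot\|$ the spectral norm. For $A=(a_{ij})\in\mathbb C^{n\times n}$ and $1\le k\le n-1$, $A^{(k)}=(a^{(k)}_{ij})\in\mathbb C^{(n-k)\times(n-k)}$ is the active matrix remaining after $k$ steps of Gaussian elimination without pivoting, i.e. the Schur complement $A_{22}-A_{21}A_{11}^{-1}A_{12}$ of the leading $k\times k$ principal block $A_{11}$ of $A$. Define $$\rho_{n,k}(A)=\frac{\max_{i,j}|a_{ij}^{(k)}|}{\max_{i,j}|a_{ij}|},\qquad \rho_n(A)=\max_{1\le k\le n-1}\rho_{n,k}(A).$$ *)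

theory Defs
  imports
    "HOL-Analysis.L2_Norm"
    "Jordan_Normal_Form.Gauss_Jordan_Elimination"
begin

definition spd_mats :: "nat \<Rightarrow> real mat set" where
  "spd_mats n = {P \<in> carrier_mat n n. transpose_mat P = P \<and>
     (\<forall>x \<in> carrier_vec n. x \<noteq> 0\<^sub>v n \<longrightarrow> 0 < x \<bullet> (P *\<^sub>v x))}"

definition complex_mat :: "real mat \<Rightarrow> real mat \<Rightarrow> complex mat" where
  "complex_mat P Q = map_mat complex_of_real P + \<i> \<cdot>\<^sub>m map_mat complex_of_real Q"

definition higham_mats :: "nat \<Rightarrow> complex mat set" where
  "higham_mats n = {complex_mat P Q | P Q. P \<in> spd_mats n \<and> Q \<in> spd_mats n}"

text \<open>The parts of \<open>A = B + iC\<close> are read off entrywise; the next lemma shows that this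
  recovers the matrices \<open>P\<close> and \<open>Q\<close> in the definition of \<open>higham_mats\<close>.\<close>

abbreviation Re_mat :: "complex mat \<Rightarrow> real mat" where
  "Re_mat A \<equiv> map_mat Re A"

abbreviation Im_mat :: "complex mat \<Rightarrow> real mat" where
  "Im_mat A \<equiv> map_mat Im A"

lemma parts_complex_mat:
  assumes "P \<in> carrier_mat n m" "Q \<in> carrier_mat n m"
  shows "Re_mat (complex_mat P Q) = P" "Im_mat (complex_mat P Q) = Q"
  using assms by (auto simp: complex_mat_def)

definition euclidean_norm :: "'a :: real_normed_field vec \<Rightarrow> real" where
  "euclidean_norm v = L2_set (\<lambda>i. norm (v $ i)) {..<dim_vec v}"

text \<open>The operator norm induced by the Euclidean norm, over the field of the entries. For a real
  matrix the supremum over real vectors equals the supremum over complex vectors. Meaningful only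
  for at least one column, since otherwise there is no unit vector.\<close>

definition spectral_norm :: "'a :: real_normed_field mat \<Rightarrow> real" where
  "spectral_norm X =
     (SUP v \<in> {v \<in> carrier_vec (dim_col X). euclidean_norm v = 1}. euclidean_norm (X *\<^sub>v v))"

text \<open>\<open>mat_inverse\<close> returns \<open>None\<close> on singular matrices, so \<open>inv_mat\<close>, and with it
  \<open>cond_number\<close> and \<open>schur_complement\<close>, is unspecified unless the matrix (respectively the
  leading block) is invertible. Positive definite matrices and leading principal blocks of Higham
  matrices always are.\<close>

definition inv_mat :: "'a :: field mat \<Rightarrow> 'a mat" where
  "inv_mat X = the (mat_inverse X)"

definition cond_number :: "'a :: real_normed_field mat \<Rightarrow> real" where
  "cond_number X = spectral_norm X * spectral_norm (inv_mat X)"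

definition schur_complement :: "'a :: field mat \<Rightarrow> nat \<Rightarrow> 'a mat" where
  "schur_complement A k =
     (case split_block A k k of (A11, A12, A21, A22) \<Rightarrow> A22 - A21 * inv_mat A11 * A12)"

definition max_entry :: "complex mat \<Rightarrow> real" where
  "max_entry A = Max (cmod ` elements_mat A)"

text \<open>The order \<open>n\<close> in \<open>\<rho>\<^bsub>n,k\<^esub>(A)\<close> and \<open>\<rho>\<^bsub>n\<^esub>(A)\<close> is the dimension of \<open>A\<close>.\<close>

definition stage_growth :: "nat \<Rightarrow> complex mat \<Rightarrow> real" where
  "stage_growth k A = max_entry (schur_complement A k) / max_entry A"

definition growth_factor :: "complex mat \<Rightarrow> real" where
  "growth_factor A = Max ((\<lambda>k. stage_growth k A) ` {1..dim_row A - 1})"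

end

theory Submission
  imports Defs
begin

text \<open>The values of both bounds are attained by explicit matrices, and the statements that a constant cannot
  be improved follow by evaluating the supposed bound at these matrices.

  For the lower bound, take \<open>A = (1 + i) diag(\<omega>, 1, \<dots>, 1)\<close>. Both parts are
  \<open>diag(\<omega>, 1, \<dots>, 1)\<close>, of condition number \<open>\<omega>\<close>. Elimination leaves a diagonal matrix unchanged
  outside the pivot rows, so the first step removes the large entry and every later active matrix
  is \<open>1 + i\<close> times an identity matrix.

  For the upper bound, let \<open>B\<close> have diagonal entries \<open>a = (\<omega> + 1)/2\<close> and off-diagonal entries
  \<open>b = (\<omega> - 1)/2\<close>, and let \<open>C\<close> be \<open>B\<close> with \<open>b\<close> replaced by \<open>-b\<close>. Both have the eigenvalues
  \<open>a + b = \<omega>\<close> and \<open>a - b = 1\<close>. The opposite signs make the off-diagonal entry of \<open>A\<close> equal to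
  \<open>(1 - i) b = -i (1 + i) b\<close>, a quarter turn away from the direction \<open>1 + i\<close> of the pivot, so that
  its square over the pivot is \<open>-(1 + i) b\<^sup>2/a\<close>. The subtraction in the Schur complement therefore
  becomes an addition without cancellation: the remaining entry is \<open>(1 + i) a (1 + b\<^sup>2/a\<^sup>2)\<close>, and
  \<open>1 + b\<^sup>2/a\<^sup>2 = 2(1 + \<omega>\<^sup>2)/(1 + \<omega>)\<^sup>2\<close>.\<close>

section \<open>Norms, inverses and Schur complements\<close>

lemma spectral_norm_eqI:
  fixes X :: "'a :: real_normed_field mat"
  assumes bound: "\<And>v. v \<in> carrier_vec (dim_col X) \<Longrightarrow>
      euclidean_norm (X *\<^sub>v v) \<le> c * euclidean_norm v"
    and u: "u \<in> carrier_vec (dim_col X)" "euclidean_norm u = 1"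
    and attained: "euclidean_norm (X *\<^sub>v u) = c"
  shows "spectral_norm X = c"
  unfolding spectral_norm_def
proof (rule cSup_eq_maximum)
  show "c \<in> (\<lambda>v. euclidean_norm (X *\<^sub>v v)) `
      {v \<in> carrier_vec (dim_col X). euclidean_norm v = 1}"
    using u attained by auto
qed (use bound in fastforce)

text \<open>An inverse exhibited by hand excludes the case in which Gauss--Jordan elimination fails, and
  it agrees with the computed one because two-sided inverses are unique.\<close>

lemma inv_mat_eqI:
  fixes A :: "'a :: field mat"
  assumes A: "A \<in> carrier_mat n n" and B: "B \<in> carrier_mat n n"
    and AB: "A * B = 1\<^sub>m n" and BA: "B * A = 1\<^sub>m n"
  shows "inv_mat A = B"
proof (cases "mat_inverse A")
  case None
  have "A \<in> Units (ring_mat TYPE('a) n ())"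
    using A B AB BA by (auto simp: Units_def ring_mat_def)
  with mat_inverse(1)[OF A None, of "()"] show ?thesis by simp
next
  case (Some C)
  from mat_inverse(2)[OF A Some] have C: "C * A = 1\<^sub>m n" "C \<in> carrier_mat n n" by auto
  have "C = C * (A * B)" using C AB by simp
  also have "\<dots> = (C * A) * B" using assoc_mult_mat[OF C(2) A B] by simp
  also have "\<dots> = B" using B C by simp
  finally show ?thesis using Some by (simp add: inv_mat_def)
qed

lemma max_entry_eqI:
  assumes A: "A \<in> carrier_mat nr nc"
    and bound: "\<And>i j. i < nr \<Longrightarrow> j < nc \<Longrightarrow> cmod (A $$ (i, j)) \<le> c"
    and attained: "k < nr" "l < nc" "cmod (A $$ (k, l)) = c"
  shows "max_entry A = c"
  unfolding max_entry_def
proof (rule Max_eqI)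
  show "finite (cmod ` elements_mat A)" by (simp add: elements_mat_def)
  show "c \<in> cmod ` elements_mat A" using A attained by blast
  show "y \<le> c" if "y \<in> cmod ` elements_mat A" for y
    using that A bound by (auto dest!: elements_matD)
qed

text \<open>Diagonal matrices are the case of interest: if the upper right block vanishes, elimination
  has nothing to subtract from the trailing block.\<close>

lemma schur_complement_block_lower_triangular:
  assumes A: "A \<in> carrier_mat n n" and k: "k \<le> n"
    and zero: "\<And>i j. i < k \<Longrightarrow> k \<le> j \<Longrightarrow> j < n \<Longrightarrow> A $$ (i, j) = 0"
  shows "schur_complement A k = mat (n - k) (n - k) (\<lambda>(i, j). A $$ (i + k, j + k))"
  using A k zero
  by (intro eq_matI) (auto simp: schur_complement_def split_block_def Let_def scalar_prod_def)

lemma schur_complement_2x2: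
  fixes A :: "'a :: field mat"
  assumes A: "A \<in> carrier_mat 2 2" and pivot: "A $$ (0, 0) \<noteq> 0"
  shows "schur_complement A 1 =
    mat 1 1 (\<lambda>_. A $$ (1, 1) - A $$ (1, 0) * A $$ (0, 1) / A $$ (0, 0))"
proof -
  have inv: "inv_mat (mat 1 1 (\<lambda>ij. A $$ ij)) = mat 1 1 (\<lambda>_. 1 / A $$ (0, 0))"
    by (rule inv_mat_eqI[of _ 1]) (use pivot in \<open>auto intro!: eq_matI simp: scalar_prod_def\<close>)
  show ?thesis
    using A
    by (intro eq_matI)
       (auto simp: schur_complement_def split_block_def Let_def scalar_prod_def inv[simplified])
qed

section \<open>Diagonal matrices and the lower bound\<close>

lemma mat_diag_mult_vec:
  fixes f :: "nat \<Rightarrow> 'a :: semiring_0"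
  assumes "v \<in> carrier_vec n"
  shows "mat_diag n f *\<^sub>v v = vec n (\<lambda>i. f i * v $ i)"
proof (rule eq_vecI)
  fix i assume "i < dim_vec (vec n (\<lambda>i. f i * v $ i))"
  hence i: "i < n" by simp
  have "(mat_diag n f *\<^sub>v v) $ i = (\<Sum>j<n. (if i = j then f j else 0) * v $ j)"
    using i assms by (simp add: mat_diag_def scalar_prod_def atLeast0LessThan)
  also have "\<dots> = (\<Sum>j<n. if j = i then f j * v $ j else 0)"
    by (rule sum.cong) auto
  also have "\<dots> = f i * v $ i" using i by simp
  finally show "(mat_diag n f *\<^sub>v v) $ i = vec n (\<lambda>i. f i * v $ i) $ i" using i by simp
qed (simp add: mat_diag_def)

lemma mat_diag_spd:
  assumes "\<And>i. i < n \<Longrightarrow> 0 < f i"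
  shows "mat_diag n f \<in> spd_mats n"
  unfolding spd_mats_def
proof (safe)
  show "transpose_mat (mat_diag n f) = mat_diag n f"
    by (rule eq_matI) (auto simp: mat_diag_def)
next
  fix x :: "real vec"
  assume x: "x \<in> carrier_vec n" and "x \<noteq> 0\<^sub>v n"
  then obtain i where i: "i < n" "x $ i \<noteq> 0" by (metis carrier_vecD eq_vecI index_zero_vec)
  have "x \<bullet> (mat_diag n f *\<^sub>v x) = (\<Sum>j<n. f j * (x $ j)\<^sup>2)"
    using x by (auto simp: mat_diag_mult_vec scalar_prod_def power2_eq_square atLeast0LessThan
      intro!: sum.cong)
  also have "\<dots> > 0"
    by (rule sum_pos2[of _ i]) (use i assms in \<open>auto simp: less_imp_le\<close>)
  finally show "0 < x \<bullet> (mat_diag n f *\<^sub>v x)" .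
qed simp

lemma spectral_norm_mat_diag:
  fixes f :: "nat \<Rightarrow> real"
  assumes bound: "\<And>i. i < n \<Longrightarrow> \<bar>f i\<bar> \<le> m" and k: "k < n" "\<bar>f k\<bar> = m"
  shows "spectral_norm (mat_diag n f) = m"
proof (rule spectral_norm_eqI)
  have dim: "dim_col (mat_diag n f) = n" by (simp add: mat_diag_def)
  have unit: "euclidean_norm (vec n (\<lambda>i. c * unit_vec n k $ i)) = \<bar>c\<bar>" for c :: real
  proof -
    have "(\<Sum>i<n. (c * unit_vec n k $ i)\<^sup>2) = (\<Sum>i<n. if i = k then c\<^sup>2 else 0)"
      using k by (intro sum.cong) auto
    also have "\<dots> = c\<^sup>2" using k by simp
    finally show ?thesis by (simp add: euclidean_norm_def L2_set_def)
  qed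
  have "vec n (\<lambda>i. 1 * unit_vec n k $ i) = (unit_vec n k :: real vec)" by auto
  with unit[of 1] show "euclidean_norm (unit_vec n k :: real vec) = 1" by simp
  have "mat_diag n f *\<^sub>v unit_vec n k = vec n (\<lambda>i. f k * unit_vec n k $ i)"
    using k by (auto simp: mat_diag_mult_vec)
  with unit[of "f k"] k show "euclidean_norm (mat_diag n f *\<^sub>v unit_vec n k) = m" by simp
  show "unit_vec n k \<in> carrier_vec (dim_col (mat_diag n f))" by (simp add: dim)
  fix v :: "real vec"
  assume "v \<in> carrier_vec (dim_col (mat_diag n f))"
  hence v: "v \<in> carrier_vec n" by (simp add: dim)
  have "0 \<le> m" using k by linarith
  have "euclidean_norm (mat_diag n f *\<^sub>v v) = L2_set (\<lambda>i. \<bar>f i * v $ i\<bar>) {..<n}"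
    using v by (auto simp: mat_diag_mult_vec euclidean_norm_def intro!: L2_set_cong)
  also have "\<dots> \<le> L2_set (\<lambda>i. m * \<bar>v $ i\<bar>) {..<n}"
    by (rule L2_set_mono) (use bound in \<open>auto simp: abs_mult intro!: mult_right_mono\<close>)
  also have "\<dots> = m * euclidean_norm v"
    using v \<open>0 \<le> m\<close> by (simp add: euclidean_norm_def L2_set_right_distrib)
  finally show "euclidean_norm (mat_diag n f *\<^sub>v v) \<le> m * euclidean_norm v" .
qed

lemma inv_mat_mat_diag:
  fixes f :: "nat \<Rightarrow> 'a :: field"
  assumes "\<And>i. i < n \<Longrightarrow> f i \<noteq> 0"
  shows "inv_mat (mat_diag n f) = mat_diag n (\<lambda>i. inverse (f i))"
proof -
  have "mat_diag n (\<lambda>i. f i * inverse (f i)) = 1\<^sub>m n" "mat_diag n (\<lambda>i. inverse (f i) * f i) = 1\<^sub>m n"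
    by (rule eq_matI; use assms in \<open>simp add: mat_diag_def\<close>)+
  thus ?thesis by (intro inv_mat_eqI[of _ n]) simp_all
qed

lemma diagonal_higham_attains_lower_bound:
  fixes \<omega> :: real
  assumes \<omega>: "1 \<le> \<omega>" and n: "2 \<le> n"
  shows "\<exists>A \<in> higham_mats n. diagonal_mat A \<and>
      cond_number (Re_mat A) = \<omega> \<and> cond_number (Im_mat A) = \<omega> \<and>
      (\<forall>k\<in>{1..n - 1}. stage_growth k A = 1 / \<omega>)"
proof -
  define d where "d i = (if i = 0 then \<omega> else 1)" for i :: nat
  define D where "D = mat_diag n d"
  define A where "A = complex_mat D D"
  have d: "0 < d i" for i using \<omega> by (simp add: d_def)
  have D: "D \<in> carrier_mat n n" by (simp add: D_def)
  have A: "A \<in> carrier_mat n n" using D by (simp add: A_def complex_mat_def)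
  have "D \<in> spd_mats n" unfolding D_def by (rule mat_diag_spd) (rule d)
  hence higham: "A \<in> higham_mats n" unfolding higham_mats_def A_def by blast
  have entry: "A $$ (i, j) = (if i = j then (1 + \<i>) * d i else 0)" if "i < n" "j < n" for i j
    using that by (simp add: A_def complex_mat_def D_def mat_diag_def algebra_simps)
  have "spectral_norm D = \<omega>"
    unfolding D_def by (rule spectral_norm_mat_diag[of n _ _ 0]) (use \<omega> n in \<open>auto simp: d_def\<close>)
  moreover have "spectral_norm (inv_mat D) = 1"
  proof -
    have "inv_mat D = mat_diag n (\<lambda>i. inverse (d i))"
      unfolding D_def by (rule inv_mat_mat_diag) (use d in \<open>auto simp: less_imp_neq[symmetric]\<close>)
    \<comment> \<open>attained at an entry other than the first one, and there is one because \<open>n \<ge> 2\<close>\<close>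
    moreover have "spectral_norm (mat_diag n (\<lambda>i. inverse (d i))) = 1"
      by (rule spectral_norm_mat_diag[of n _ _ 1])
         (use \<omega> n in \<open>auto simp: d_def inverse_le_1_iff\<close>)
    ultimately show ?thesis by simp
  qed
  ultimately have cond: "cond_number D = \<omega>" by (simp add: cond_number_def)
  have growth: "stage_growth k A = 1 / \<omega>" if k: "k \<in> {1..n - 1}" for k
  proof -
    have "max_entry A = cmod (1 + \<i>) * \<omega>"
      by (rule max_entry_eqI[OF A, of _ 0 0])
         (use n \<omega> in \<open>auto simp: entry d_def norm_mult mult_le_cancel_left1\<close>)
    moreover have "schur_complement A k = mat (n - k) (n - k) (\<lambda>(i, j). A $$ (i + k, j + k))"
      by (rule schur_complement_block_lower_triangular[OF A]) (use k in \<open>auto simp: entry\<close>)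
    moreover have "max_entry (mat (n - k) (n - k) (\<lambda>(i, j). A $$ (i + k, j + k))) = cmod (1 + \<i>)"
      by (rule max_entry_eqI[of _ "n - k" "n - k" _ 0 0]) (use k in \<open>auto simp: entry d_def\<close>)
    moreover have "cmod (1 + \<i>) \<noteq> 0" by (simp add: complex_eq_iff)
    ultimately show ?thesis using \<omega> by (simp add: stage_growth_def)
  qed
  have "diagonal_mat A" using A by (auto simp: diagonal_mat_def entry)
  moreover have "Re_mat A = D" "Im_mat A = D" unfolding A_def by (rule parts_complex_mat[OF D D])+
  ultimately show ?thesis using higham cond growth by metis
qed

section \<open>Symmetric two-by-two matrices with constant diagonal and the upper bound\<close>

definition sym_toeplitz2 :: "'a \<Rightarrow> 'a \<Rightarrow> 'a mat" where
  "sym_toeplitz2 a s = mat 2 2 (\<lambda>(i, j). if i = j then a else s)"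

lemma sym_toeplitz2_carrier [simp]: "sym_toeplitz2 a s \<in> carrier_mat 2 2"
  by (simp add: sym_toeplitz2_def)

lemma sym_toeplitz2_mult_vec:
  fixes a s :: "'a :: comm_semiring_0"
  assumes "v \<in> carrier_vec 2"
  shows "(sym_toeplitz2 a s *\<^sub>v v) $ 0 = a * v $ 0 + s * v $ 1"
    and "(sym_toeplitz2 a s *\<^sub>v v) $ 1 = s * v $ 0 + a * v $ 1"
    and "dim_vec (sym_toeplitz2 a s *\<^sub>v v) = 2"
  using assms by (auto simp: sym_toeplitz2_def scalar_prod_def numeral_2_eq_2)

lemma euclidean_norm_2:
  fixes v :: "real vec"
  assumes "dim_vec v = 2"
  shows "euclidean_norm v = sqrt ((v $ 0)\<^sup>2 + (v $ 1)\<^sup>2)"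
  using assms by (simp add: euclidean_norm_def L2_set_def numeral_2_eq_2)

text \<open>The cross term \<open>2 s x y\<close> of the quadratic form is at most \<open>\<bar>s\<bar> (x\<^sup>2 + y\<^sup>2)\<close> in absolute value,
  so the diagonal part \<open>a (x\<^sup>2 + y\<^sup>2)\<close> dominates it.\<close>

lemma sym_toeplitz2_spd:
  assumes "\<bar>s\<bar> < a"
  shows "sym_toeplitz2 a s \<in> spd_mats 2"
  unfolding spd_mats_def
proof (safe)
  show "transpose_mat (sym_toeplitz2 a s) = sym_toeplitz2 a s"
    by (rule eq_matI) (auto simp: sym_toeplitz2_def)
next
  fix x :: "real vec"
  assume x: "x \<in> carrier_vec 2" and nz: "x \<noteq> 0\<^sub>v 2"
  let ?p = "x $ 0" and ?q = "x $ 1"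
  have "?p \<noteq> 0 \<or> ?q \<noteq> 0"
  proof (rule ccontr)
    assume "\<not> ?thesis"
    hence "x = 0\<^sub>v 2" using x by (intro eq_vecI) (auto simp: less_2_cases_iff)
    with nz show False by simp
  qed
  hence pos: "0 < ?p\<^sup>2 + ?q\<^sup>2" by (simp add: sum_power2_gt_zero_iff)
  have "2 * \<bar>?p * ?q\<bar> \<le> ?p\<^sup>2 + ?q\<^sup>2"
    using sum_squares_bound[of "\<bar>?p\<bar>" "\<bar>?q\<bar>"] by (simp add: abs_mult mult.assoc)
  hence "\<bar>s\<bar> * (2 * \<bar>?p * ?q\<bar>) \<le> \<bar>s\<bar> * (?p\<^sup>2 + ?q\<^sup>2)" by (rule mult_left_mono) simp
  also have "\<dots> < a * (?p\<^sup>2 + ?q\<^sup>2)" using assms pos by (rule mult_strict_right_mono)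
  finally have "\<bar>2 * s * (?p * ?q)\<bar> < a * (?p\<^sup>2 + ?q\<^sup>2)" by (simp add: abs_mult mult_ac)
  hence "0 < a * (?p\<^sup>2 + ?q\<^sup>2) + 2 * s * (?p * ?q)" by linarith
  also have "\<dots> = x \<bullet> (sym_toeplitz2 a s *\<^sub>v x)"
  proof -
    have "x \<bullet> (sym_toeplitz2 a s *\<^sub>v x) =
        ?p * (sym_toeplitz2 a s *\<^sub>v x) $ 0 + ?q * (sym_toeplitz2 a s *\<^sub>v x) $ 1"
      using sym_toeplitz2_mult_vec(3)[OF x] by (simp add: scalar_prod_def numeral_2_eq_2)
    thus ?thesis using x by (simp only: sym_toeplitz2_mult_vec power2_eq_square algebra_simps)
  qed
  finally show "0 < x \<bullet> (sym_toeplitz2 a s *\<^sub>v x)" .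
qed simp

text \<open>The eigenvectors are \<open>(1, 1)\<close> and \<open>(1, -1)\<close>, with eigenvalues \<open>a + s\<close> and \<open>a - s\<close>. The one
  whose eigenvalue is larger in absolute value depends on whether \<open>a\<close> and \<open>s\<close> agree in sign.\<close>

lemma spectral_norm_sym_toeplitz2:
  fixes a s :: real
  shows "spectral_norm (sym_toeplitz2 a s) = \<bar>a\<bar> + \<bar>s\<bar>"
proof (rule spectral_norm_eqI)
  have dim: "dim_col (sym_toeplitz2 a s) = 2" by (simp add: sym_toeplitz2_def)
  define e where "e = (if 0 \<le> a * s then 1 else - 1 :: real)"
  define u where "u = vec 2 (\<lambda>i. if i = 0 then 1 / sqrt 2 else e / sqrt 2)"
  have e: "e\<^sup>2 = 1" "\<bar>a + s * e\<bar> = \<bar>a\<bar> + \<bar>s\<bar>"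
    by (auto simp: e_def zero_le_mult_iff mult_less_0_iff not_le)
  have u: "u \<in> carrier_vec 2" "u $ 0 = 1 / sqrt 2" "u $ 1 = e / sqrt 2" by (auto simp: u_def)
  show "u \<in> carrier_vec (dim_col (sym_toeplitz2 a s))" using u dim by simp
  show "euclidean_norm u = 1"
    using u e by (simp add: euclidean_norm_2 power_divide)
  have "euclidean_norm (sym_toeplitz2 a s *\<^sub>v u) =
      sqrt ((a * u $ 0 + s * u $ 1)\<^sup>2 + (s * u $ 0 + a * u $ 1)\<^sup>2)"
    using u(1) by (simp only: euclidean_norm_2 sym_toeplitz2_mult_vec)
  also have "(a * u $ 0 + s * u $ 1)\<^sup>2 + (s * u $ 0 + a * u $ 1)\<^sup>2 =
      ((a + s * e)\<^sup>2 + (s + a * e)\<^sup>2) / 2"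
    using u by (simp add: power_divide add_divide_distrib[symmetric])
  also have "\<dots> = (a + s * e)\<^sup>2"
  proof -
    have "s + a * e = e * (a + s * e)" using e(1) by (simp add: algebra_simps power2_eq_square)
    thus ?thesis using e(1) by (simp add: power_mult_distrib)
  qed
  finally show "euclidean_norm (sym_toeplitz2 a s *\<^sub>v u) = \<bar>a\<bar> + \<bar>s\<bar>" using e by simp
  fix v :: "real vec"
  assume "v \<in> carrier_vec (dim_col (sym_toeplitz2 a s))"
  hence v: "v \<in> carrier_vec 2" by (simp add: dim)
  let ?p = "v $ 0" and ?q = "v $ 1"
  have "2 * \<bar>?p * ?q\<bar> \<le> ?p\<^sup>2 + ?q\<^sup>2"
    using sum_squares_bound[of "\<bar>?p\<bar>" "\<bar>?q\<bar>"] by (simp add: abs_mult mult.assoc)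
  hence "2 * \<bar>a * s\<bar> * (2 * \<bar>?p * ?q\<bar>) \<le> 2 * \<bar>a * s\<bar> * (?p\<^sup>2 + ?q\<^sup>2)"
    by (rule mult_left_mono) simp
  moreover have "4 * (a * s) * (?p * ?q) \<le> 2 * \<bar>a * s\<bar> * (2 * \<bar>?p * ?q\<bar>)"
    using abs_ge_self[of "(a * s) * (?p * ?q)"] by (simp add: abs_mult)
  ultimately have "4 * (a * s) * (?p * ?q) \<le> 2 * \<bar>a * s\<bar> * (?p\<^sup>2 + ?q\<^sup>2)" by linarith
  moreover have "(\<bar>a\<bar> + \<bar>s\<bar>)\<^sup>2 = a\<^sup>2 + s\<^sup>2 + 2 * \<bar>a * s\<bar>"
    by (simp add: power2_sum abs_mult)
  ultimately have "(a * ?p + s * ?q)\<^sup>2 + (s * ?p + a * ?q)\<^sup>2 \<le> (\<bar>a\<bar> + \<bar>s\<bar>)\<^sup>2 * (?p\<^sup>2 + ?q\<^sup>2)"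
    by (simp add: power2_eq_square algebra_simps)
  hence "sqrt ((a * ?p + s * ?q)\<^sup>2 + (s * ?p + a * ?q)\<^sup>2) \<le>
      sqrt ((\<bar>a\<bar> + \<bar>s\<bar>)\<^sup>2 * (?p\<^sup>2 + ?q\<^sup>2))"
    by (rule real_sqrt_le_mono)
  also have "\<dots> = (\<bar>a\<bar> + \<bar>s\<bar>) * sqrt (?p\<^sup>2 + ?q\<^sup>2)" by (simp add: real_sqrt_mult)
  finally show "euclidean_norm (sym_toeplitz2 a s *\<^sub>v v) \<le> (\<bar>a\<bar> + \<bar>s\<bar>) * euclidean_norm v"
    using v by (simp only: euclidean_norm_2 sym_toeplitz2_mult_vec carrier_vecD)
qed

lemma cond_number_sym_toeplitz2:
  assumes "\<bar>s\<bar> < a"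
  shows "cond_number (sym_toeplitz2 a s) = (a + \<bar>s\<bar>) / (a - \<bar>s\<bar>)"
proof -
  \<comment> \<open>the determinant, by which the adjugate is divided\<close>
  define D where "D = a\<^sup>2 - s\<^sup>2"
  have D: "D = (a - \<bar>s\<bar>) * (a + \<bar>s\<bar>)" by (simp add: D_def power2_eq_square algebra_simps)
  have "0 < D" unfolding D using assms by (intro mult_pos_pos) auto
  have "sym_toeplitz2 a s * sym_toeplitz2 (a / D) (- s / D) = 1\<^sub>m 2"
       "sym_toeplitz2 (a / D) (- s / D) * sym_toeplitz2 a s = 1\<^sub>m 2"
    using \<open>0 < D\<close>
    by (auto intro!: eq_matI
        simp: sym_toeplitz2_def scalar_prod_def less_2_cases_iff diff_divide_distrib[symmetric]
          numeral_2_eq_2)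
       (simp_all add: D_def power2_eq_square mult.commute)
  hence "inv_mat (sym_toeplitz2 a s) = sym_toeplitz2 (a / D) (- s / D)"
    by (intro inv_mat_eqI[of _ 2]) auto
  moreover have "\<bar>a / D\<bar> + \<bar>- s / D\<bar> = 1 / (a - \<bar>s\<bar>)"
  proof -
    have "\<bar>a / D\<bar> + \<bar>- s / D\<bar> = (a + \<bar>s\<bar>) / D"
      using \<open>0 < D\<close> assms by (simp add: add_divide_distrib)
    also have "\<dots> = 1 / (a - \<bar>s\<bar>)" unfolding D using assms by (simp add: add_pos_nonneg)
    finally show ?thesis .
  qed
  ultimately show ?thesis using assms
    by (simp add: cond_number_def spectral_norm_sym_toeplitz2)
qed

lemma higham_2x2_attains_upper_bound:
  fixes \<omega> :: real
  assumes \<omega>: "1 \<le> \<omega>"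
  shows "\<exists>A \<in> higham_mats 2.
      cond_number (Re_mat A) = \<omega> \<and> cond_number (Im_mat A) = \<omega> \<and>
      growth_factor A = 2 * (1 + \<omega>\<^sup>2) / (1 + \<omega>)\<^sup>2"
proof -
  define a where "a = (\<omega> + 1) / 2"
  define b where "b = (\<omega> - 1) / 2"
  define B where "B = sym_toeplitz2 a b"
  define C where "C = sym_toeplitz2 a (- b)"
  define A where "A = complex_mat B C"
  have ab: "0 \<le> b" "b < a" "0 < a" "a + b = \<omega>" "a - b = 1"
    using \<omega> by (auto simp: a_def b_def field_simps)
  have carr: "B \<in> carrier_mat 2 2" "C \<in> carrier_mat 2 2" by (auto simp: B_def C_def)
  have A: "A \<in> carrier_mat 2 2" using carr by (simp add: A_def complex_mat_def)
  have "B \<in> spd_mats 2" "C \<in> spd_mats 2"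
    unfolding B_def C_def using ab by (auto intro!: sym_toeplitz2_spd)
  hence higham: "A \<in> higham_mats 2" unfolding higham_mats_def A_def by blast
  have cond: "cond_number B = \<omega>" "cond_number C = \<omega>"
    unfolding B_def C_def using ab by (simp_all add: cond_number_sym_toeplitz2)
  have entry: "A $$ (i, j) = (if i = j then (1 + \<i>) * a else (1 - \<i>) * b)"
    if "i < 2" "j < 2" for i j
    using that by (simp add: A_def complex_mat_def B_def C_def sym_toeplitz2_def algebra_simps)
  have cmod: "cmod (1 + \<i>) = sqrt 2" "cmod (1 - \<i>) = sqrt 2" by (simp_all add: cmod_def)
  have max_A: "max_entry A = sqrt 2 * a"
    by (rule max_entry_eqI[OF A, of _ 0 0]) (use ab in \<open>auto simp: entry norm_mult cmod\<close>)
  have pivot: "(1 + \<i>) * complex_of_real a \<noteq> 0" using ab by (simp add: complex_eq_iff)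
  have "schur_complement A 1 = mat 1 1 (\<lambda>_. (1 + \<i>) * of_real (a + b\<^sup>2 / a))"
  proof -
    have "(1 - \<i>) * b * ((1 - \<i>) * b) / ((1 + \<i>) * a) = - ((1 + \<i>) * of_real (b\<^sup>2 / a))"
    proof -
      have "(1 - \<i>) * b * ((1 - \<i>) * b) = - ((1 + \<i>) * of_real (b\<^sup>2 / a)) * ((1 + \<i>) * a)"
        using ab by (simp add: complex_eq_iff power2_eq_square)
      thus ?thesis using pivot by simp
    qed
    thus ?thesis using schur_complement_2x2[OF A] pivot by (simp add: entry distrib_left)
  qed
  moreover have "max_entry (mat 1 1 (\<lambda>_. (1 + \<i>) * of_real (a + b\<^sup>2 / a))) =
      sqrt 2 * (a + b\<^sup>2 / a)"
    using ab by (intro max_entry_eqI[of _ 1 1 _ 0 0])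
      (auto simp: norm_mult cmod simp del: of_real_add of_real_divide)
  ultimately have "stage_growth 1 A = (a + b\<^sup>2 / a) / a"
    by (simp add: stage_growth_def max_A)
  also have "\<dots> = 2 * (1 + \<omega>\<^sup>2) / (1 + \<omega>)\<^sup>2"
  proof -
    have "(a + b\<^sup>2 / a) / a = (4 * a\<^sup>2 + 4 * b\<^sup>2) / (2 * a)\<^sup>2"
      using \<open>0 < a\<close> by (simp add: field_simps power2_eq_square)
    also have "4 * a\<^sup>2 + 4 * b\<^sup>2 = 2 * (1 + \<omega>\<^sup>2)"
      by (simp add: a_def b_def power2_eq_square field_simps)
    also have "2 * a = 1 + \<omega>" by (simp add: a_def)
    finally show ?thesis .
  qed
  finally have "growth_factor A = 2 * (1 + \<omega>\<^sup>2) / (1 + \<omega>)\<^sup>2"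
    using A by (simp add: growth_factor_def)
  moreover have "Re_mat A = B" "Im_mat A = C" unfolding A_def using carr by (rule parts_complex_mat)+
  ultimately show ?thesis using higham cond by metis
qed

section \<open>Sharpness of both constants\<close>

theorem theorem1p4:
  fixes \<omega> :: real
  assumes "1 \<le> \<omega>"
  shows
    "(\<forall>n\<ge>2. \<exists>A \<in> higham_mats n. diagonal_mat A \<and>
        cond_number (Re_mat A) = \<omega> \<and> cond_number (Im_mat A) = \<omega> \<and>
        (\<forall>k\<in>{1..n - 1}. stage_growth k A = 1 / \<omega>)) \<and>
     (\<forall>n\<ge>2. \<forall>k\<in>{1..n - 1}. \<forall>c > 1 / \<omega>.
        \<not> (\<forall>A \<in> higham_mats n. max (cond_number (Re_mat A)) (cond_number (Im_mat A)) \<le> \<omega>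
              \<longrightarrow> stage_growth k A \<ge> c) \<and>
        \<not> (\<forall>A \<in> higham_mats n. cond_number (Re_mat A) = \<omega> \<and> cond_number (Im_mat A) = \<omega>
              \<longrightarrow> stage_growth k A \<ge> c)) \<and>
     (\<exists>A \<in> higham_mats 2.
        cond_number (Re_mat A) = \<omega> \<and> cond_number (Im_mat A) = \<omega> \<and>
        growth_factor A = 2 * (1 + \<omega>\<^sup>2) / (1 + \<omega>)\<^sup>2) \<and>
     (\<forall>c < 2 * (1 + \<omega>\<^sup>2) / (1 + \<omega>)\<^sup>2.
        \<not> (\<forall>n\<ge>2. \<forall>A \<in> higham_mats n.
              max (cond_number (Re_mat A)) (cond_number (Im_mat A)) \<le> \<omega>
              \<longrightarrow> growth_factor A \<le> c))"
proof (intro conjI)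
  show "\<forall>n\<ge>2. \<exists>A \<in> higham_mats n. diagonal_mat A \<and>
        cond_number (Re_mat A) = \<omega> \<and> cond_number (Im_mat A) = \<omega> \<and>
        (\<forall>k\<in>{1..n - 1}. stage_growth k A = 1 / \<omega>)"
    using diagonal_higham_attains_lower_bound[OF assms] by blast
  show "\<forall>n\<ge>2. \<forall>k\<in>{1..n - 1}. \<forall>c > 1 / \<omega>.
        \<not> (\<forall>A \<in> higham_mats n. max (cond_number (Re_mat A)) (cond_number (Im_mat A)) \<le> \<omega>
              \<longrightarrow> stage_growth k A \<ge> c) \<and>
        \<not> (\<forall>A \<in> higham_mats n. cond_number (Re_mat A) = \<omega> \<and> cond_number (Im_mat A) = \<omega>
              \<longrightarrow> stage_growth k A \<ge> c)"
  proof (intro allI ballI impI)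
    fix n k :: nat and c :: real assume "2 \<le> n" and k: "k \<in> {1..n - 1}" and c: "1 / \<omega> < c"
    from diagonal_higham_attains_lower_bound[OF assms \<open>2 \<le> n\<close>] k
    obtain A where "A \<in> higham_mats n" "cond_number (Re_mat A) = \<omega>" "cond_number (Im_mat A) = \<omega>"
      "stage_growth k A = 1 / \<omega>" by blast
    moreover from this c have "\<not> stage_growth k A \<ge> c" by simp
    ultimately show "\<not> (\<forall>A \<in> higham_mats n.
          max (cond_number (Re_mat A)) (cond_number (Im_mat A)) \<le> \<omega> \<longrightarrow> stage_growth k A \<ge> c) \<and>
        \<not> (\<forall>A \<in> higham_mats n. cond_number (Re_mat A) = \<omega> \<and> cond_number (Im_mat A) = \<omega>
          \<longrightarrow> stage_growth k A \<ge> c)"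
      by (metis max.idem order_refl)
  qed
  show "\<exists>A \<in> higham_mats 2.
        cond_number (Re_mat A) = \<omega> \<and> cond_number (Im_mat A) = \<omega> \<and>
        growth_factor A = 2 * (1 + \<omega>\<^sup>2) / (1 + \<omega>)\<^sup>2"
    by (rule higham_2x2_attains_upper_bound[OF assms])
  show "\<forall>c < 2 * (1 + \<omega>\<^sup>2) / (1 + \<omega>)\<^sup>2.
        \<not> (\<forall>n\<ge>2. \<forall>A \<in> higham_mats n.
              max (cond_number (Re_mat A)) (cond_number (Im_mat A)) \<le> \<omega>
              \<longrightarrow> growth_factor A \<le> c)"
  proof (intro allI impI)
    fix c assume c: "c < 2 * (1 + \<omega>\<^sup>2) / (1 + \<omega>)\<^sup>2"
    from higham_2x2_attains_upper_bound[OF assms]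
    obtain A where "A \<in> higham_mats 2" "cond_number (Re_mat A) = \<omega>" "cond_number (Im_mat A) = \<omega>"
      "growth_factor A = 2 * (1 + \<omega>\<^sup>2) / (1 + \<omega>)\<^sup>2" by blast
    moreover from this c have "\<not> growth_factor A \<le> c" by simp
    ultimately show "\<not> (\<forall>n\<ge>2. \<forall>A \<in> higham_mats n.
          max (cond_number (Re_mat A)) (cond_number (Im_mat A)) \<le> \<omega> \<longrightarrow> growth_factor A \<le> c)"
      by (metis max.idem order_refl)
  qed
qed

end
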